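(* Let $G$ be a graph on $n$ vertices and $m$ edges. Let $\lambda_1\geq \lambda_2\geq\cdots\geq \lambda_n$ be all eigenvalues of $G$. Then $$t(G)=\frac{1}{6}\sum_{i=2}^n(\lambda_1+\lambda_i)\lambda_i^2+\frac{\lambda_1(\lambda_1^2-m)}{3}\geq \frac{\lambda(G)(\lambda^2(G)-m)}{3}.$$ In particular, equality holds in the inequality $t(G)\geq \frac{\lambda(G)(\lambda^2(G)-m)}{3}$ if and only if $G$ is a complete bipartite graph (possibly with some isolated vertices).
   Context: Graphs are simple and undirected. The eigenvalues of $G$ are the eigenvalues of its adjacency matrix $A(G)$. $\lambda(G)$ denotes the spectral radius of $G$, i.e. the maximum of the moduli of the eigenvalues of $A(G)$; it is equal to $\lambda_1$. $t(G)$ denotes the number of triangles in $G$. *)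

theory Defs
  imports "Graph_Theory.Kuratowski" "Jordan_Normal_Form.Spectral_Radius"
begin

text \<open>
  A finite simple undirected graph is a \<open>pair_graph\<close>: a finite, loop-free, symmetric set of ordered
  pairs. An undirected edge \<open>uv\<close> is thus represented by the two arcs \<open>(u, v)\<close> and \<open>(v, u)\<close>.
\<close>

definition num_edges :: "'a pair_pre_digraph \<Rightarrow> nat" where
  "num_edges G = card ((\<lambda>(u, v). {u, v}) ` parcs G)"

definition triangles :: "'a pair_pre_digraph \<Rightarrow> 'a set set" where
  "triangles G = {T. T \<subseteq> pverts G \<and> card T = 3 \<and> (\<forall>u\<in>T. \<forall>v\<in>T. u \<noteq> v \<longrightarrow> (u, v) \<in> parcs G)}"

text \<open>
  \<open>I\<close> is the set of isolated vertices that are added. The parts of \<open>K\<^bsub>a,b\<^esub>\<close> may be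
  empty, so that an edgeless graph counts as a (degenerate) complete bipartite graph
  with isolated vertices.
\<close>

definition complete_bipartite_with_isolated :: "'a pair_pre_digraph \<Rightarrow> bool" where
  "complete_bipartite_with_isolated G \<longleftrightarrow>
     (\<exists>I \<subseteq> pverts G. (\<forall>v\<in>I. \<forall>u. (u, v) \<notin> parcs G \<and> (v, u) \<notin> parcs G) \<and>
        (\<exists>a b. K\<^bsub>a,b\<^esub> (with_proj G \<restriction> (pverts G - I))))"

definition adj_matrix :: "'a pair_pre_digraph \<Rightarrow> 'a list \<Rightarrow> real mat" where
  "adj_matrix G vs = mat (length vs) (length vs)
     (\<lambda>(i, j). if (vs ! i, vs ! j) \<in> parcs G then 1 else 0)"

text \<open>
  The real eigenvalues, repeated according to algebraic multiplicity, in non-increasing order.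
  For an adjacency matrix these are all the eigenvalues: the list has length \<open>n\<close>, as shown below.
\<close>

definition eigenvalue_list :: "real mat \<Rightarrow> real list" where
  "eigenvalue_list A = rev (sorted_list_of_multiset (proots (char_poly A)))"

lemma symmetric_real_eigenvalue_in_Reals:
  fixes A :: "real mat"
  assumes A: "A \<in> carrier_mat n n"
    and sym: "\<And>i j. i < n \<Longrightarrow> j < n \<Longrightarrow> A $$ (i, j) = A $$ (j, i)"
    and ev: "eigenvalue (map_mat complex_of_real A) k"
  shows "k \<in> \<real>"
proof -
  obtain v where v: "v \<in> carrier_vec n" "v \<noteq> 0\<^sub>v n"
    and eq: "map_mat complex_of_real A *\<^sub>v v = k \<cdot>\<^sub>v v"
    using ev A unfolding eigenvalue_def eigenvector_def by auto
  have row: "(\<Sum>j<n. of_real (A $$ (i, j)) * v $ j) = k * v $ i" if "i < n" for i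
  proof -
    have "(map_mat complex_of_real A *\<^sub>v v) $ i = (k \<cdot>\<^sub>v v) $ i"
      using eq by simp
    then show ?thesis
      using that A v by (simp add: scalar_prod_def atLeast0LessThan)
  qed
  define S where "S = (\<Sum>i<n. \<Sum>j<n. cnj (v $ i) * of_real (A $$ (i, j)) * v $ j)"
  define N where "N = (\<Sum>i<n. (cmod (v $ i))\<^sup>2)"
  have S: "S = k * of_real N"
  proof -
    have "S = (\<Sum>i<n. cnj (v $ i) * (\<Sum>j<n. of_real (A $$ (i, j)) * v $ j))"
      unfolding S_def by (simp add: sum_distrib_left mult.assoc)
    also have "\<dots> = (\<Sum>i<n. cnj (v $ i) * (k * v $ i))"
      by (intro sum.cong) (auto simp: row)
    also have "\<dots> = k * of_real N"
      unfolding N_def of_real_sum sum_distrib_left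
      by (intro sum.cong) (auto simp: complex_norm_square algebra_simps simp del: of_real_power)
    finally show ?thesis .
  qed
  have "cnj S = (\<Sum>i<n. \<Sum>j<n. v $ i * of_real (A $$ (i, j)) * cnj (v $ j))"
    unfolding S_def by simp
  also have "\<dots> = (\<Sum>j<n. \<Sum>i<n. v $ i * of_real (A $$ (i, j)) * cnj (v $ j))"
    by (rule sum.swap)
  also have "\<dots> = S"
    unfolding S_def by (intro sum.cong refl) (auto simp: sym algebra_simps)
  finally have "cnj k * of_real N = k * of_real N"
    unfolding S by simp
  moreover have "N \<noteq> 0"
  proof
    assume "N = 0"
    then have "\<forall>i<n. v $ i = 0"
      unfolding N_def by (subst (asm) sum_nonneg_eq_0_iff) auto
    with v show False by auto
  qed
  ultimately show ?thesis
    by (simp add: Reals_cnj_iff)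
qed

lemma length_eigenvalue_list_adj_matrix:
  assumes "pair_graph G" "distinct vs" "set vs = pverts G"
  shows "length (eigenvalue_list (adj_matrix G vs)) = card (pverts G)"
proof -
  interpret pair_graph G by fact
  define n where "n = length vs"
  define A where "A = adj_matrix G vs"
  define B where "B = map_mat complex_of_real A"
  have A: "A \<in> carrier_mat n n"
    by (simp add: A_def n_def adj_matrix_def)
  then have B: "B \<in> carrier_mat n n"
    by (simp add: B_def)
  have sym: "A $$ (i, j) = A $$ (j, i)" if "i < n" "j < n" for i j
    using that pair_sym_arcs
    by (auto simp: A_def n_def adj_matrix_def symmetric_def dest: symD)
  obtain as where as: "char_poly B = (\<Prod>a\<leftarrow>as. [:- a, 1:])" "length as = n"
    using char_poly_factorized[OF B] by blast
  have real: "complex_of_real (Re a) = a" if "a \<in> set as" for a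
  proof -
    have "poly (char_poly B) a = 0"
      unfolding as poly_prod_list using that by (auto simp: prod_list_zero_iff)
    then have "a \<in> \<real>"
      using symmetric_real_eigenvalue_in_Reals[OF A sym] eigenvalue_root_char_poly[OF B]
      unfolding B_def by blast
    then show ?thesis by (simp add: of_real_Re)
  qed
  interpret h: map_poly_inj_comm_ring_hom complex_of_real ..
  have "map_poly complex_of_real (char_poly A) = char_poly B"
    unfolding B_def by (simp add: of_real_hom.char_poly_hom[OF A])
  also have "\<dots> = map_poly complex_of_real (\<Prod>a\<leftarrow>as. [:- Re a, 1:])"
    unfolding as h.hom_prod_list map_map
    by (intro arg_cong[where f = prod_list] map_cong) (auto simp: real)
  finally have cp: "char_poly A = (\<Prod>a\<leftarrow>as. [:- Re a, 1:])"
    by (simp only: h.eq_iff)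
  have "size (proots (char_poly A)) = length as"
    unfolding cp
  proof (induction as)
    case (Cons a as)
    have "(\<Prod>a\<leftarrow>as. [:- Re a, 1:]) \<noteq> 0"
      by (auto simp: prod_list_zero_iff)
    then show ?case
      using Cons by (simp add: proots_mult del: mult_pCons_left)
  qed simp
  then show ?thesis
    using as(2) distinct_card[OF assms(2)] assms(3)
    by (simp add: eigenvalue_list_def A_def n_def flip: size_mset)
qed

end

theory Submission
  imports Defs
begin

text \<open>
  Let \<open>A\<close> be the adjacency matrix. The trace of \<open>A\<^sup>k\<close> counts closed walks of length \<open>k\<close> and is
  also the \<open>k\<close>-th power sum of the eigenvalues (Schur triangularisation,
  \<open>mat_trace_pow_eq_power_sum\<close>). Hence the power sums of degree 1, 2, 3 are \<open>0\<close>, \<open>2m\<close> and \<open>6t\<close>,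
  and the formula for \<open>t\<close> is a rearrangement of
  \<open>(\<lambda>\<^sub>1 + \<lambda>\<^sub>i) \<lambda>\<^sub>i\<^sup>2 = \<lambda>\<^sub>1 \<lambda>\<^sub>i\<^sup>2 + \<lambda>\<^sub>i\<^sup>3\<close>, summed over \<open>i \<ge> 2\<close>.

  The inequality says that this sum is nonnegative, which follows from \<open>\<bar>\<lambda>\<^sub>i\<bar> \<le> \<lambda>\<^sub>1 = \<rho>\<close>. This part of
  Perron--Frobenius theory is read off from traces as well: a nonnegative matrix has nonnegative
  power sums, but a negative eigenvalue of modulus larger than the greatest eigenvalue would
  dominate the power sums of large odd degree (\<open>abs_le_if_power_sums_nonneg\<close>).

  Both directions of the equality case pass through the matrix equation \<open>A\<^sup>3 = m A\<close>. If the sum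
  vanishes, every \<open>\<lambda>\<^sub>i\<close> with \<open>i \<ge> 2\<close> is \<open>0\<close> or \<open>-\<lambda>\<^sub>1\<close>, and the first two power sums force
  \<open>m = \<lambda>\<^sub>1\<^sup>2\<close>; so every eigenvalue satisfies \<open>\<lambda>\<^sup>3 = m \<lambda>\<close>. For the symmetric matrix \<open>A\<close> this is
  equivalent to \<open>A\<^sup>3 = m A\<close>, because the sum of the squared entries of \<open>A\<^sup>3 - m A\<close> is the sum of
  \<open>(\<lambda>\<^sub>i\<^sup>3 - m \<lambda>\<^sub>i)\<^sup>2\<close> (\<open>symmetric_cube_eq_smult_iff\<close>).
  Combinatorially, \<open>A\<^sup>3 = m A\<close> says that adjacent vertices are joined by exactly \<open>m\<close> walks of
  length three and nonadjacent or equal ones by none. The latter excludes triangles and completes every path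
  of length three to a four-cycle; the former says that every edge is the middle edge of a walk
  joining the ends of any given edge \<open>uv\<close>, so it runs between the disjoint neighbourhoods of
  \<open>u\<close> and \<open>v\<close> (\<open>bipartite_if_card_walks3\<close>).
  Conversely, a complete bipartite graph satisfies the equation, so \<open>t = 0\<close> and \<open>\<rho>\<^sup>3 = m \<rho>\<close>.
\<close>

section \<open>Traces of powers and power sums of eigenvalues\<close>

definition mat_trace :: "'a::comm_monoid_add mat \<Rightarrow> 'a" where
  "mat_trace A = (\<Sum>i<dim_row A. A $$ (i, i))"

lemma index_mult_mat_sum:
  assumes "A \<in> carrier_mat n n" "B \<in> carrier_mat n n" "i < n" "j < n"
  shows "(A * B) $$ (i, j) = (\<Sum>k<n. A $$ (i, k) * B $$ (k, j))"
  using assms by (auto simp: scalar_prod_def atLeast0LessThan intro!: sum.cong)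

lemma index_pow_mat_Suc:
  assumes A: "A \<in> carrier_mat n n" and "i < n" "j < n"
  shows "(A ^\<^sub>m Suc k) $$ (i, j) = (\<Sum>l<n. (A ^\<^sub>m k) $$ (i, l) * A $$ (l, j))"
  using index_mult_mat_sum[OF pow_carrier_mat[OF A] A assms(2,3)] by simp

lemma mat_trace_mult_commute:
  fixes A B :: "'a::comm_semiring_0 mat"
  assumes A: "A \<in> carrier_mat n n" and B: "B \<in> carrier_mat n n"
  shows "mat_trace (A * B) = mat_trace (B * A)"
proof -
  have "mat_trace (A * B) = (\<Sum>i<n. \<Sum>k<n. A $$ (i, k) * B $$ (k, i))"
    using A by (auto simp: mat_trace_def index_mult_mat_sum[OF A B] intro!: sum.cong)
  also have "\<dots> = (\<Sum>k<n. \<Sum>i<n. B $$ (k, i) * A $$ (i, k))"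
    by (subst sum.swap) (simp add: mult.commute)
  also have "\<dots> = mat_trace (B * A)"
    using B by (auto simp: mat_trace_def index_mult_mat_sum[OF B A] intro!: sum.cong)
  finally show ?thesis .
qed

lemma mat_trace_similar:
  fixes A B :: "'a::comm_ring_1 mat"
  assumes "similar_mat_wit A B P Q"
  shows "mat_trace A = mat_trace B"
proof -
  define n where "n = dim_row A"
  note sim = similar_mat_witD[OF n_def assms]
  note A = sim(4) and B = sim(5) and P = sim(6) and Q = sim(7)
  have PB: "P * B \<in> carrier_mat n n"
    using P B by (rule mult_carrier_mat)
  have "mat_trace A = mat_trace (Q * (P * B))"
    unfolding sim(3) using PB Q by (rule mat_trace_mult_commute)
  also have "Q * (P * B) = B"
    unfolding assoc_mult_mat[OF Q P B, symmetric] sim(2) using B by (rule left_mult_one_mat)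
  finally show ?thesis .
qed

lemma upper_triangular_pow:
  fixes B :: "'a::comm_ring_1 mat"
  assumes B: "B \<in> carrier_mat n n" and tri: "upper_triangular B"
  shows "i < n \<Longrightarrow> j \<le> i \<Longrightarrow>
    (B ^\<^sub>m k) $$ (i, j) = (if i = j then (B $$ (i, i)) ^ k else 0)"
proof (induction k arbitrary: i j)
  case 0
  then show ?case using B by (auto simp: carrier_matD)
next
  case (Suc k)
  have tri': "B $$ (l, j) = 0" if "j < l" "l < n" for l
    using tri that B by auto
  have "(B ^\<^sub>m Suc k) $$ (i, j) = (\<Sum>l<n. (B ^\<^sub>m k) $$ (i, l) * B $$ (l, j))"
    using Suc.prems by (intro index_pow_mat_Suc[OF B]) auto
  also have "\<dots> = (\<Sum>l<n. if l = i then (B ^\<^sub>m k) $$ (i, i) * B $$ (i, j) else 0)"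
  proof (intro sum.cong refl)
    fix l assume l: "l \<in> {..<n}"
    consider "l < i" | "l = i" | "i < l" by linarith
    then show "(B ^\<^sub>m k) $$ (i, l) * B $$ (l, j)
        = (if l = i then (B ^\<^sub>m k) $$ (i, i) * B $$ (i, j) else 0)"
      using l Suc.prems Suc.IH[of i l] tri'[of l] by cases auto
  qed
  also have "\<dots> = (B ^\<^sub>m k) $$ (i, i) * B $$ (i, j)"
    using Suc.prems by simp
  also have "\<dots> = (if i = j then (B $$ (i, i)) ^ Suc k else 0)"
    using Suc.prems Suc.IH[of i i] tri'[of i] by auto
  finally show ?case .
qed

text \<open>
  Schur triangularisation makes \<open>A\<close> similar to an upper triangular matrix whose diagonal lists the
  roots of the characteristic polynomial; powers act entrywise on that diagonal.
\<close>

lemma mat_trace_pow_eq_power_sum: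
  fixes A :: "'a::conjugatable_ordered_field mat"
  assumes A: "A \<in> carrier_mat n n"
    and cp: "char_poly A = (\<Prod>e\<leftarrow>es. [:- e, 1:])"
  shows "mat_trace (A ^\<^sub>m k) = (\<Sum>e\<leftarrow>es. e ^ k)"
proof -
  obtain B P Q where "schur_decomposition A es = (B, P, Q)"
    by (cases "schur_decomposition A es") auto
  from schur_decomposition[OF A cp this]
  have sim: "similar_mat_wit A B P Q" and tri: "upper_triangular B" and es: "diag_mat B = es"
    by auto
  from similar_mat_witD2[OF A sim] have B: "B \<in> carrier_mat n n"
    by blast
  have "mat_trace (A ^\<^sub>m k) = mat_trace (B ^\<^sub>m k)"
    by (rule mat_trace_similar[OF similar_mat_wit_pow[OF sim]])
  also have "\<dots> = (\<Sum>i<n. (B $$ (i, i)) ^ k)"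
    using B by (auto simp: mat_trace_def upper_triangular_pow[OF B tri] intro!: sum.cong)
  also have "\<dots> = (\<Sum>e\<leftarrow>es. e ^ k)"
    using B unfolding es[symmetric]
    by (simp add: diag_mat_def sum_list_sum_nth comp_def atLeast0LessThan)
  finally show ?thesis .
qed

lemma pow_mat_add:
  fixes A :: "'a::semiring_1 mat"
  assumes A: "A \<in> carrier_mat n n"
  shows "A ^\<^sub>m (p + q) = A ^\<^sub>m p * A ^\<^sub>m q"
proof (induction q)
  case 0
  have "A ^\<^sub>m p * 1\<^sub>m n = A ^\<^sub>m p"
    by (rule right_mult_one_mat[OF pow_carrier_mat[OF A]])
  then show ?case using carrier_matD[OF A] by simp
next
  case (Suc q)
  have "A ^\<^sub>m (p + Suc q) = A ^\<^sub>m p * A ^\<^sub>m q * A"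
    by (simp add: Suc)
  also have "\<dots> = A ^\<^sub>m p * (A ^\<^sub>m q * A)"
    by (rule assoc_mult_mat[OF pow_carrier_mat[OF A] pow_carrier_mat[OF A] A])
  finally show ?case by simp
qed

lemma pow_mat_symmetric:
  fixes A :: "'a::comm_semiring_1 mat"
  assumes A: "A \<in> carrier_mat n n"
    and sym: "transpose_mat A = A"
  shows "transpose_mat (A ^\<^sub>m k) = A ^\<^sub>m k"
proof (induction k)
  case 0
  then show ?case by simp
next
  case (Suc k)
  have "transpose_mat (A ^\<^sub>m Suc k) = A * A ^\<^sub>m k"
    using Suc sym by (simp add: transpose_mult[OF pow_carrier_mat[OF A] A])
  also have "\<dots> = A ^\<^sub>m 1 * A ^\<^sub>m k"
    using A by simp
  also have "\<dots> = A ^\<^sub>m Suc k"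
    using pow_mat_add[OF A, of 1 k] by simp
  finally show ?case .
qed

text \<open>
  Transposing the second factor, which changes nothing as \<open>A\<close> is symmetric, turns the entrywise
  inner product of two powers into the trace of their matrix product. Over the reals this makes the sum of
  the squared entries of any polynomial in \<open>A\<close> computable from the eigenvalues, without diagonalising \<open>A\<close>.
\<close>

lemma frobenius_pow_eq_trace:
  fixes A :: "'a::comm_semiring_1 mat"
  assumes A: "A \<in> carrier_mat n n" and sym: "transpose_mat A = A"
  shows "(\<Sum>i<n. \<Sum>j<n. (A ^\<^sub>m p) $$ (i, j) * (A ^\<^sub>m q) $$ (i, j)) = mat_trace (A ^\<^sub>m (p + q))"
proof -
  have "mat_trace (A ^\<^sub>m (p + q))
      = (\<Sum>i<n. \<Sum>j<n. (A ^\<^sub>m p) $$ (i, j) * (A ^\<^sub>m q) $$ (j, i))"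
    using A unfolding pow_mat_add[OF A]
    by (auto simp: mat_trace_def index_mult_mat_sum[OF pow_carrier_mat[OF A] pow_carrier_mat[OF A]]
        simp del: index_mult_mat(1) intro!: sum.cong)
  also have "\<dots> = (\<Sum>i<n. \<Sum>j<n. (A ^\<^sub>m p) $$ (i, j) * (A ^\<^sub>m q) $$ (i, j))"
  proof (intro sum.cong refl)
    fix i j assume "i \<in> {..<n}" "j \<in> {..<n}"
    then have "transpose_mat (A ^\<^sub>m q) $$ (i, j) = (A ^\<^sub>m q) $$ (j, i)"
      using A by simp
    then show "(A ^\<^sub>m p) $$ (i, j) * (A ^\<^sub>m q) $$ (j, i) = (A ^\<^sub>m p) $$ (i, j) * (A ^\<^sub>m q) $$ (i, j)"
      by (simp add: pow_mat_symmetric[OF A sym])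
  qed
  finally show ?thesis ..
qed

text \<open>
  Both sides state that a sum of squares vanishes: the squared entries of \<open>A\<^sup>3 - c A\<close> on the left,
  the values \<open>(e\<^sup>3 - c e)\<^sup>2\<close> on the right. The two sums are equal, since each expands into
  the same combination of traces of \<open>A\<^sup>6\<close>, \<open>A\<^sup>4\<close> and \<open>A\<^sup>2\<close>.
\<close>

lemma symmetric_cube_eq_smult_iff:
  fixes A :: "real mat"
  assumes A: "A \<in> carrier_mat n n" and sym: "transpose_mat A = A"
    and cp: "char_poly A = (\<Prod>e\<leftarrow>es. [:- e, 1:])"
  shows "(\<forall>i<n. \<forall>j<n. (A ^\<^sub>m 3) $$ (i, j) = c * A $$ (i, j)) \<longleftrightarrow> (\<forall>e\<in>set es. e ^ 3 = c * e)"
proof -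
  let ?d = "\<lambda>i j. (A ^\<^sub>m 3) $$ (i, j) - c * (A ^\<^sub>m 1) $$ (i, j)"
  let ?F = "\<lambda>p q. \<Sum>i<n. \<Sum>j<n. (A ^\<^sub>m p) $$ (i, j) * (A ^\<^sub>m q) $$ (i, j)"
  have F: "?F p q = (\<Sum>e\<leftarrow>es. e ^ (p + q))" for p q
    unfolding frobenius_pow_eq_trace[OF A sym] mat_trace_pow_eq_power_sum[OF A cp] ..
  have "(\<Sum>i<n. \<Sum>j<n. (?d i j)\<^sup>2) = ?F 3 3 - 2 * c * ?F 3 1 + c\<^sup>2 * ?F 1 1"
    by (simp add: power2_eq_square algebra_simps sum.distrib sum_subtractf sum_distrib_left)
  also have "\<dots> = (\<Sum>e\<leftarrow>es. (e ^ 3 - c * e)\<^sup>2)"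
    unfolding F by (induction es) (simp_all add: power2_eq_square algebra_simps eval_nat_numeral)
  finally have eq: "(\<Sum>i<n. \<Sum>j<n. (?d i j)\<^sup>2) = (\<Sum>e\<leftarrow>es. (e ^ 3 - c * e)\<^sup>2)" .
  have "(\<forall>i<n. \<forall>j<n. ?d i j = 0) \<longleftrightarrow> (\<forall>i\<in>{..<n}. \<forall>j\<in>{..<n}. ?d i j = 0)"
    by blast
  also have "\<dots> \<longleftrightarrow> (\<Sum>i<n. \<Sum>j<n. (?d i j)\<^sup>2) = 0"
    by (simp add: sum_nonneg_eq_0_iff sum_nonneg)
  also have "\<dots> \<longleftrightarrow> (\<forall>e\<in>set es. e ^ 3 - c * e = 0)"
    unfolding eq by (subst sum_list_nonneg_eq_0_iff) auto
  finally show ?thesis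
    using A by auto
qed

section \<open>The spectral radius of a nonnegative matrix\<close>

lemma pow_mat_nonneg:
  fixes A :: "'a::linordered_semidom mat"
  assumes A: "A \<in> carrier_mat n n"
    and nonneg: "\<And>i j. i < n \<Longrightarrow> j < n \<Longrightarrow> A $$ (i, j) \<ge> 0"
  shows "i < n \<Longrightarrow> j < n \<Longrightarrow> (A ^\<^sub>m k) $$ (i, j) \<ge> 0"
proof (induction k arbitrary: i j)
  case 0
  then show ?case using A by simp
next
  case (Suc k)
  then show ?case using nonneg unfolding index_pow_mat_Suc[OF A Suc.prems]
    by (intro sum_nonneg mult_nonneg_nonneg) auto
qed

text \<open>
  If some \<open>x\<close> were below \<open>-M\<close>, then for odd \<open>k\<close> the negative term \<open>x\<^sup>k\<close> would have to be
  compensated by the others, which contribute at most \<open>length es * M\<^sup>k\<close>. This fails for large \<open>k\<close>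
  because \<open>M / \<bar>x\<bar> < 1\<close>.
\<close>

lemma abs_le_if_power_sums_nonneg:
  fixes M x :: real
  assumes sums: "\<And>k. odd k \<Longrightarrow> (\<Sum>e\<leftarrow>es. e ^ k) \<ge> 0"
    and M: "\<And>e. e \<in> set es \<Longrightarrow> e \<le> M" and x: "x \<in> set es"
  shows "\<bar>x\<bar> \<le> M"
proof (rule ccontr)
  assume "\<not> \<bar>x\<bar> \<le> M"
  with M[OF x] have neg: "x < 0" "M < - x" by (auto simp: abs_if split: if_splits)
  have bound: "(\<Sum>e\<leftarrow>ys. e ^ k) \<le> length ys * M ^ k"
    if "odd k" "set ys \<subseteq> set es" for k :: nat and ys
    using that(2)
  proof (induction ys)
    case (Cons y ys)
    have "y ^ k \<le> M ^ k"
      using Cons.prems M that(1) by (intro power_mono_odd) auto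
    then show ?case using Cons by (simp add: algebra_simps)
  qed simp
  \<comment> \<open>The power sum of degree one is at most a multiple of \<open>M\<close>.\<close>
  have M0: "M \<ge> 0"
  proof -
    have "0 \<le> length es * M"
      using sums[of 1] bound[of 1 es] by simp
    then show ?thesis
      using x by (auto simp: zero_le_mult_iff)
  qed
  define r where "r = M / (- x)"
  have r: "0 \<le> r" "r < 1"
    using neg M0 by (auto simp: r_def field_simps)
  have odd_bound: "1 \<le> length es * r ^ k" if k: "odd k" for k :: nat
  proof -
    have split: "(\<Sum>e\<leftarrow>es. e ^ k) = x ^ k + (\<Sum>e\<leftarrow>remove1 x es. e ^ k)"
      by (rule sum_list_map_remove1[OF x])
    have "(\<Sum>e\<leftarrow>remove1 x es. e ^ k) \<le> length (remove1 x es) * M ^ k"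
      using k set_remove1_subset by (rule bound)
    also have "\<dots> \<le> length es * M ^ k"
      using M0 by (intro mult_right_mono) (auto simp: length_remove1)
    finally have "(- x) ^ k \<le> length es * M ^ k"
      using sums[OF k] k split by simp
    moreover have "(- x) ^ k > 0"
      using neg by simp
    ultimately show ?thesis
      unfolding r_def power_divide by (metis le_divide_eq_1_pos times_divide_eq_right)
  qed
  have "(\<lambda>k. length es * r ^ k) \<longlonglongrightarrow> real (length es) * 0"
    using r by (intro tendsto_intros LIMSEQ_power_zero) auto
  then have "eventually (\<lambda>k. length es * r ^ k < 1) sequentially"
    by (intro order_tendstoD) auto
  then obtain N where "\<And>k. k \<ge> N \<Longrightarrow> length es * r ^ k < 1"
    by (auto simp: eventually_sequentially)
  from this[of "2 * N + 1"] odd_bound[of "2 * N + 1"] show False by simp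
qed

lemma spectrum_of_real_mat:
  fixes A :: "real mat"
  assumes A: "A \<in> carrier_mat n n"
    and cp: "char_poly A = (\<Prod>e\<leftarrow>es. [:- e, 1:])"
  shows "spectrum (map_mat complex_of_real A) = complex_of_real ` set es"
proof -
  interpret h: map_poly_inj_comm_ring_hom complex_of_real ..
  have B: "map_mat complex_of_real A \<in> carrier_mat n n"
    using A by simp
  have "char_poly (map_mat complex_of_real A) = (\<Prod>e\<leftarrow>es. [:- complex_of_real e, 1:])"
    unfolding of_real_hom.char_poly_hom[OF A] cp h.hom_prod_list map_map
    by (simp add: comp_def)
  then show ?thesis
    unfolding spectrum_root_char_poly[OF B] by (auto simp: poly_prod_list prod_list_zero_iff)
qed

text \<open>
  Perron--Frobenius for matrices with real spectrum: the powers of a nonnegative matrix have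
  nonnegative trace, so no eigenvalue exceeds the greatest one in modulus.
\<close>

lemma spectral_radius_nonneg_mat:
  fixes A :: "real mat"
  assumes A: "A \<in> carrier_mat n n"
    and nonneg: "\<And>i j. i < n \<Longrightarrow> j < n \<Longrightarrow> A $$ (i, j) \<ge> 0"
    and cp: "char_poly A = (\<Prod>e\<leftarrow>es. [:- e, 1:])"
    and M: "M \<in> set es" "\<And>e. e \<in> set es \<Longrightarrow> e \<le> M"
  shows "spectral_radius (map_mat complex_of_real A) = M"
    and "e \<in> set es \<Longrightarrow> \<bar>e\<bar> \<le> M"
proof -
  have "(\<Sum>e\<leftarrow>es. e ^ k) \<ge> 0" for k
    unfolding mat_trace_pow_eq_power_sum[OF A cp, symmetric]
    using A pow_mat_nonneg[OF A nonneg] by (auto simp: mat_trace_def intro!: sum_nonneg)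
  from abs_le_if_power_sums_nonneg[OF this M(2)]
  have abs: "\<bar>e\<bar> \<le> M" if "e \<in> set es" for e
    using that by blast
  then show "e \<in> set es \<Longrightarrow> \<bar>e\<bar> \<le> M" .
  have "norm ` spectrum (map_mat complex_of_real A) = abs ` set es"
    unfolding spectrum_of_real_mat[OF A cp] by (simp add: image_image)
  moreover have "M \<in> abs ` set es"
    using M(1) abs[OF M(1)] by (intro image_eqI[of _ _ M]) auto
  ultimately show "spectral_radius (map_mat complex_of_real A) = M"
    unfolding spectral_radius_def using abs by (auto intro!: Max_eqI)
qed

section \<open>The spectrum of the adjacency matrix\<close>

lemma monic_eq_prod_proots:
  fixes p :: "'a::idom poly"
  assumes "lead_coeff p = 1" "size (proots p) = degree p"
  shows "p = (\<Prod>a\<in>#proots p. [:- a, 1:])"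
  using assms
proof (induction "degree p" arbitrary: p)
  case 0
  then have "p = 1"
    by (metis degree_0_id monic_degree_0)
  then show ?case by simp
next
  case (Suc d)
  from Suc.prems(2) Suc.hyps(2) have "proots p \<noteq> {#}" by auto
  then obtain a where "a \<in># proots p" by auto
  moreover have "p \<noteq> 0" using Suc.prems(1) by auto
  ultimately have "poly p a = 0" by simp
  then obtain q where p: "p = [:- a, 1:] * q"
    by (auto simp: poly_eq_0_iff_dvd)
  have "q \<noteq> 0" using \<open>p \<noteq> 0\<close> p by auto
  then have deg: "degree p = Suc (degree q)" and pr: "proots p = add_mset a (proots q)"
    unfolding p by (simp_all add: degree_mult_eq proots_mult del: mult_pCons_left)
  have lead: "lead_coeff p = lead_coeff q"
    unfolding p lead_coeff_mult by simp
  have "q = (\<Prod>a\<in>#proots q. [:- a, 1:])"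
    using Suc deg pr lead by (intro Suc.hyps(1)) auto
  then show ?case
    using p pr by (metis image_mset_add_mset prod_mset.add_mset)
qed

lemma char_poly_adj_matrix:
  assumes "pair_graph G" "distinct vs" "set vs = pverts G"
  shows "char_poly (adj_matrix G vs) = (\<Prod>e\<leftarrow>eigenvalue_list (adj_matrix G vs). [:- e, 1:])"
proof -
  let ?A = "adj_matrix G vs"
  have A: "?A \<in> carrier_mat (length vs) (length vs)"
    by (simp add: adj_matrix_def)
  have mset: "mset (eigenvalue_list ?A) = proots (char_poly ?A)"
    by (simp add: eigenvalue_list_def)
  have "size (proots (char_poly ?A)) = degree (char_poly ?A)"
    using length_eigenvalue_list_adj_matrix[OF assms] degree_monic_char_poly[OF A]
      distinct_card[OF assms(2)] assms(3) by (simp flip: mset)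
  then have "char_poly ?A = (\<Prod>a\<in>#proots (char_poly ?A). [:- a, 1:])"
    using degree_monic_char_poly[OF A] by (intro monic_eq_prod_proots) auto
  also have "\<dots> = (\<Prod>e\<leftarrow>eigenvalue_list ?A. [:- e, 1:])"
    unfolding mset[symmetric] mset_map[symmetric] prod_mset_prod_list ..
  finally show ?thesis .
qed

section \<open>Walks, edges and triangles\<close>

text \<open>
  A walk of length three from \<open>u\<close> to \<open>v\<close> is represented by its middle arc, which determines it.
\<close>

definition walks3 :: "'a pair_pre_digraph \<Rightarrow> 'a \<Rightarrow> 'a \<Rightarrow> ('a \<times> 'a) set" where
  "walks3 G u v = {(x, y) \<in> parcs G. (u, x) \<in> parcs G \<and> (y, v) \<in> parcs G}"

lemma (in pair_graph) arcs_sym: "(u, v) \<in> parcs G \<longleftrightarrow> (v, u) \<in> parcs G"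
  using pair_sym_arcs by (auto simp: symmetric_def dest: symD)

lemma (in pair_graph) arcs_irrefl: "(u, u) \<notin> parcs G"
  using pair_no_loops[of "(u, u)"] by auto

lemma (in pair_graph) finite_walks3: "finite (walks3 G u v)"
  by (rule finite_subset[OF _ pair_finite_arcs]) (auto simp: walks3_def)

lemma adj_matrix_carrier: "adj_matrix G vs \<in> carrier_mat (length vs) (length vs)"
  by (simp add: adj_matrix_def)

lemma index_adj_matrix:
  assumes "i < length vs" "j < length vs"
  shows "adj_matrix G vs $$ (i, j) = of_bool ((vs ! i, vs ! j) \<in> parcs G)"
  using assms by (simp add: adj_matrix_def)

lemma (in pair_graph) transpose_adj_matrix: "transpose_mat (adj_matrix G vs) = adj_matrix G vs"
  using arcs_sym by (intro eq_matI) (auto simp: adj_matrix_def)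

lemma sum_nth_eq_sum_set:
  assumes "distinct vs"
  shows "(\<Sum>i<length vs. f (vs ! i)) = sum f (set vs)"
  using bij_betw_nth[OF assms, of "{..<length vs}" "set vs"] sum.reindex_bij_betw by blast

lemma (in pair_graph) card_filter_arcs:
  "real (card {(x, y) \<in> parcs G. P x y})
    = (\<Sum>x\<in>pverts G. \<Sum>y\<in>pverts G. of_bool ((x, y) \<in> parcs G \<and> P x y))"
proof -
  have "{(x, y) \<in> parcs G. P x y} = (SIGMA x:pverts G. {y \<in> pverts G. (x, y) \<in> parcs G \<and> P x y})"
    by (auto dest: in_arcsD1 in_arcsD2)
  then have "card {(x, y) \<in> parcs G. P x y}
      = (\<Sum>x\<in>pverts G. card {y \<in> pverts G. (x, y) \<in> parcs G \<and> P x y})"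
    using pair_finite_verts by simp
  then show ?thesis
    using pair_finite_verts by (simp add: of_bool_def sum.If_cases Int_def)
qed

lemma (in pair_graph) adj_matrix_cube:
  assumes vs: "distinct vs" "set vs = pverts G" and ij: "i < length vs" "j < length vs"
  shows "(adj_matrix G vs ^\<^sub>m 3) $$ (i, j) = card (walks3 G (vs ! i) (vs ! j))"
proof -
  let ?A = "adj_matrix G vs" and ?E = "\<lambda>u v. of_bool ((u, v) \<in> parcs G) :: real"
  note A = adj_matrix_carrier[of G vs]
  have square: "(?A ^\<^sub>m 2) $$ (i, y) = (\<Sum>x<length vs. ?E (vs ! i) (vs ! x) * ?E (vs ! x) (vs ! y))"
    if "y < length vs" for y
  proof -
    have "(?A ^\<^sub>m 2) $$ (i, y) = (\<Sum>x<length vs. ?A $$ (i, x) * ?A $$ (x, y))"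
      using index_pow_mat_Suc[OF A ij(1) that, of 1] A by (simp add: numeral_2_eq_2)
    also have "\<dots> = (\<Sum>x<length vs. ?E (vs ! i) (vs ! x) * ?E (vs ! x) (vs ! y))"
      using that ij by (intro sum.cong) (simp_all only: index_adj_matrix lessThan_iff)
    finally show ?thesis .
  qed
  have "(?A ^\<^sub>m 3) $$ (i, j) = (\<Sum>y<length vs. (?A ^\<^sub>m 2) $$ (i, y) * ?A $$ (y, j))"
    using index_pow_mat_Suc[OF A ij, of 2] by (simp add: numeral_3_eq_3 numeral_2_eq_2)
  also have "\<dots> = (\<Sum>y<length vs. (\<Sum>x<length vs. ?E (vs ! i) (vs ! x) * ?E (vs ! x) (vs ! y)) * ?E (vs ! y) (vs ! j))"
    using ij by (intro sum.cong refl) (simp only: square index_adj_matrix lessThan_iff)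
  also have "\<dots> = (\<Sum>y\<in>pverts G. (\<Sum>x\<in>pverts G. ?E (vs ! i) x * ?E x y) * ?E y (vs ! j))"
    unfolding vs(2)[symmetric] sum_nth_eq_sum_set[OF vs(1), symmetric] ..
  also have "\<dots> = (\<Sum>x\<in>pverts G. \<Sum>y\<in>pverts G. ?E (vs ! i) x * ?E x y * ?E y (vs ! j))"
    unfolding sum_distrib_right by (rule sum.swap)
  also have "\<dots> = card (walks3 G (vs ! i) (vs ! j))"
    unfolding walks3_def card_filter_arcs by (intro sum.cong) auto
  finally show ?thesis .
qed

text \<open>
  The fibres of the map from arcs to edges consist of the two orientations of an edge.
\<close>

lemma (in pair_graph) card_arcs: "card (parcs G) = 2 * num_edges G"
proof -
  let ?f = "\<lambda>(u, v). {u, v}"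
  have "card (parcs G) = (\<Sum>e \<in> ?f ` parcs G. card {a \<in> parcs G. ?f a = e})"
    using sum.group[OF pair_finite_arcs finite_imageI[OF pair_finite_arcs] subset_refl,
        of "\<lambda>_. 1::nat" ?f] by simp
  also have "\<dots> = (\<Sum>e \<in> ?f ` parcs G. 2)"
  proof (intro sum.cong refl)
    fix e assume "e \<in> ?f ` parcs G"
    then obtain u v where e: "e = {u, v}" and a: "(u, v) \<in> parcs G" by auto
    then have "{a \<in> parcs G. ?f a = e} = {(u, v), (v, u)}"
      using arcs_sym by (auto simp: doubleton_eq_iff)
    moreover have "u \<noteq> v" using a arcs_irrefl by auto
    ultimately show "card {a \<in> parcs G. ?f a = e} = 2" by simp
  qed
  finally show ?thesis by (simp add: num_edges_def)
qed

text \<open>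
  A closed walk of length three visits three distinct vertices, hence runs around a triangle; each
  triangle arises from its six orderings.
\<close>

lemma (in pair_graph) sum_card_closed_walks3:
  "(\<Sum>u\<in>pverts G. card (walks3 G u u)) = 6 * card (triangles G)"
proof -
  let ?W = "SIGMA u:pverts G. walks3 G u u" and ?f = "\<lambda>(u, x, y). {u, x, y}"
  have fin: "finite ?W" "finite (triangles G)"
    using pair_finite_verts finite_walks3
    by (auto simp: triangles_def intro: finite_subset[of _ "Pow (pverts G)"])
  have "(\<Sum>u\<in>pverts G. card (walks3 G u u)) = card ?W"
    using pair_finite_verts finite_walks3 by simp
  also have "card ?W = (\<Sum>T \<in> triangles G. card {w \<in> ?W. ?f w = T})"
  proof -
    have "?f ` ?W \<subseteq> triangles G"
    proof (clarsimp)
      fix u x y assume "u \<in> pverts G" "(x, y) \<in> walks3 G u u"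
      moreover from this have "u \<noteq> x" "x \<noteq> y" "y \<noteq> u"
        using arcs_irrefl by (auto simp: walks3_def)
      ultimately show "{u, x, y} \<in> triangles G"
        using arcs_sym by (auto simp: walks3_def triangles_def dest: in_arcsD1 in_arcsD2)
    qed
    then show ?thesis
      using sum.group[OF fin, of ?f "\<lambda>_. 1::nat"] by simp
  qed
  also have "\<dots> = (\<Sum>T \<in> triangles G. 6)"
  proof (intro sum.cong refl)
    fix T assume T: "T \<in> triangles G"
    then obtain a b c where abc: "T = {a, b, c}" "a \<noteq> b" "b \<noteq> c" "a \<noteq> c"
      by (auto simp: triangles_def card_3_iff)
    have arcs: "(u, v) \<in> parcs G" if "u \<in> T" "v \<in> T" "u \<noteq> v" for u v
      using T that by (auto simp: triangles_def)
    have "{w \<in> ?W. ?f w = T}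
        = {(a, b, c), (a, c, b), (b, a, c), (b, c, a), (c, a, b), (c, b, a)}" (is "?L = ?R")
    proof
      show "?R \<subseteq> ?L"
        using abc arcs T by (auto simp: walks3_def triangles_def)
      show "?L \<subseteq> ?R"
      proof
        fix w assume "w \<in> ?L"
        then obtain u x y where w: "w = (u, x, y)" "{u, x, y} = {a, b, c}"
          and "(x, y) \<in> walks3 G u u"
          using abc by auto
        then have "u \<noteq> x" "x \<noteq> y" "y \<noteq> u"
          using arcs_irrefl by (auto simp: walks3_def)
        moreover have "u \<in> {a, b, c}" "x \<in> {a, b, c}" "y \<in> {a, b, c}"
          using w(2) by auto
        ultimately show "w \<in> ?R" using w(1) by auto
      qed
    qed
    then show "card {w \<in> ?W. ?f w = T} = 6" using abc by simp
  qed
  finally show ?thesis by simp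
qed

section \<open>Complete bipartite graphs and walks of length three\<close>

lemma (in pair_graph) num_edges_bipartite:
  assumes UV: "U \<inter> V = {}" and arcs: "parcs G = U \<times> V \<union> V \<times> U"
  shows "num_edges G = card (U \<times> V)" "card (V \<times> U) = card (U \<times> V)"
proof -
  have "(\<lambda>(u, v). {u, v}) ` parcs G = (\<lambda>(u, v). {u, v}) ` (U \<times> V)"
    unfolding arcs by (auto simp: insert_commute image_iff)
  moreover have "inj_on (\<lambda>(u, v). {u, v}) (U \<times> V)"
    using UV by (auto simp: inj_on_def doubleton_eq_iff)
  ultimately show "num_edges G = card (U \<times> V)"
    by (simp add: num_edges_def card_image)
qed (simp add: card_cartesian_product)

text \<open>
  A walk of length three changes sides three times. From \<open>u\<close> in \<open>U\<close> it ends at a vertex \<open>v\<close> of \<open>V\<close>,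
  and its middle arc can be any arc from \<open>V\<close> to \<open>U\<close>; likewise with the sides exchanged.
\<close>

lemma (in pair_graph) card_walks3_bipartite:
  assumes UV: "U \<inter> V = {}" and arcs: "parcs G = U \<times> V \<union> V \<times> U"
  shows "card (walks3 G u v) = (if (u, v) \<in> parcs G then num_edges G else 0)"
proof -
  have "walks3 G u v = (if (u, v) \<in> parcs G then if u \<in> U then V \<times> U else U \<times> V else {})"
    using UV unfolding walks3_def arcs by auto
  then show ?thesis
    using num_edges_bipartite[OF assms] by simp
qed

text \<open>
  Fix an edge \<open>uv\<close>; the parts are the neighbourhoods of its ends. They are disjoint because there
  are no closed walks of length three, and completely joined because the ends of a walk of length
  three are adjacent. No edge is missed: the \<open>m\<close> walks from \<open>u\<close> to \<open>v\<close> have different middle edges,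
  so these exhaust the \<open>m\<close> edges of the graph.
\<close>

lemma (in pair_graph) bipartite_if_card_walks3:
  assumes walks: "\<And>u v. u \<in> pverts G \<Longrightarrow> v \<in> pverts G \<Longrightarrow>
    card (walks3 G u v) = (if (u, v) \<in> parcs G then num_edges G else 0)"
  shows "\<exists>U V. U \<inter> V = {} \<and> parcs G = U \<times> V \<union> V \<times> U"
proof (cases "parcs G = {}")
  case False
  then obtain u v where uv: "(u, v) \<in> parcs G" by auto
  have arcI: "(p, q) \<in> parcs G" if "(p, x) \<in> parcs G" "(x, y) \<in> parcs G" "(y, q) \<in> parcs G"
    for p x y q
  proof (rule ccontr)
    assume "(p, q) \<notin> parcs G"
    moreover have "p \<in> pverts G" "q \<in> pverts G"
      using that by (auto dest: in_arcsD1 in_arcsD2)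
    ultimately have "card (walks3 G p q) = 0"
      using walks by simp
    then show False
      using finite_walks3 that by (auto simp: walks3_def)
  qed
  define U where "U = {y. (y, v) \<in> parcs G}"
  define V where "V = {x. (u, x) \<in> parcs G}"
  have UV: "U \<inter> V = {}"
  proof (rule ccontr)
    assume "U \<inter> V \<noteq> {}"
    then obtain y where "(y, v) \<in> parcs G" "(u, y) \<in> parcs G"
      by (auto simp: U_def V_def)
    with uv have "(y, y) \<in> parcs G"
      using arcI[of y v u y] arcs_sym by blast
    then show False using arcs_irrefl by blast
  qed
  have complete: "(x, y) \<in> parcs G" if "x \<in> V" "y \<in> U" for x y
    using that uv arcI[of y v u x] arcs_sym unfolding U_def V_def by blast
  have sub: "walks3 G u v \<subseteq> V \<times> U"
    by (auto simp: walks3_def U_def V_def)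
  let ?f = "\<lambda>(x, y). {x, y}"
  have "inj_on ?f (V \<times> U)"
    using UV by (auto simp: inj_on_def doubleton_eq_iff)
  then have "inj_on ?f (walks3 G u v)"
    by (rule inj_on_subset) (rule sub)
  then have "card (?f ` walks3 G u v) = card (?f ` parcs G)"
    using walks[of u v] uv by (auto simp: card_image num_edges_def dest: in_arcsD1 in_arcsD2)
  then have all: "?f ` walks3 G u v = ?f ` parcs G"
    using pair_finite_arcs by (intro card_subset_eq) (auto simp: walks3_def)
  have "parcs G = U \<times> V \<union> V \<times> U"
  proof (intro equalityI subsetI)
    fix a assume "a \<in> parcs G"
    then obtain x y where "?f a = {x, y}" "(x, y) \<in> walks3 G u v"
      using all by (metis (no_types, lifting) image_iff case_prod_conv surj_pair)
    then show "a \<in> U \<times> V \<union> V \<times> U"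
      using sub by (cases a) (auto simp: doubleton_eq_iff)
  next
    fix a assume "a \<in> U \<times> V \<union> V \<times> U"
    then show "a \<in> parcs G"
      using complete arcs_sym by blast
  qed
  with UV show ?thesis by blast
qed auto

text \<open>
  Vertices outside both parts are isolated, so the isolated vertices to be removed need not be
  named.
\<close>

lemma (in pair_graph) complete_bipartite_with_isolated_iff:
  "complete_bipartite_with_isolated G
    \<longleftrightarrow> (\<exists>U V. U \<inter> V = {} \<and> parcs G = U \<times> V \<union> V \<times> U)"
proof
  assume "complete_bipartite_with_isolated G"
  then obtain I a b where iso: "\<And>v u. v \<in> I \<Longrightarrow> (u, v) \<notin> parcs G \<and> (v, u) \<notin> parcs G"
    and K: "K\<^bsub>a,b\<^esub> (with_proj G \<restriction> (pverts G - I))"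
    unfolding complete_bipartite_with_isolated_def by blast
  from K obtain U V where "U \<inter> V = {}"
    and "arcs_ends (with_proj G \<restriction> (pverts G - I)) = U \<times> V \<union> V \<times> U"
    by (auto simp: complete_bipartite_digraph_def)
  moreover have "arcs_ends (with_proj G \<restriction> (pverts G - I)) = parcs G"
    using iso by (auto simp: arcs_ends_conv image_iff dest: in_arcsD1 in_arcsD2)
  ultimately show "\<exists>U V. U \<inter> V = {} \<and> parcs G = U \<times> V \<union> V \<times> U"
    by metis
next
  assume "\<exists>U V. U \<inter> V = {} \<and> parcs G = U \<times> V \<union> V \<times> U"
  \<comment> \<open>If one part is empty, the other is unconstrained and may contain elements that are not
    vertices; then both parts are replaced by the empty set.\<close>
  then obtain U V where UV: "U \<inter> V = {}" "parcs G = U \<times> V \<union> V \<times> U" "U \<union> V \<subseteq> pverts G"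
  proof (cases "parcs G = {}")
    case True
    then show ?thesis using that[of "{}" "{}"] by simp
  next
    case False
    assume "\<exists>U V. U \<inter> V = {} \<and> parcs G = U \<times> V \<union> V \<times> U"
    then obtain U V where UV: "U \<inter> V = {}" "parcs G = U \<times> V \<union> V \<times> U" by blast
    have "U \<noteq> {}" "V \<noteq> {}"
      using False UV by auto
    then have "U \<union> V \<subseteq> pverts G"
      using UV by (blast dest: in_arcsD1 in_arcsD2)
    with UV that show ?thesis by blast
  qed
  let ?H = "\<lparr> pverts = U \<union> V, parcs = parcs G \<rparr>"
  have "with_proj G \<restriction> (pverts G - (pverts G - (U \<union> V))) = with_proj ?H"
    using UV by (auto simp: induce_subgraph_def with_proj_def)
  moreover have "K\<^bsub>card U,card V\<^esub> (with_proj ?H)"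
    unfolding complete_bipartite_digraph_pair_def
    using UV pair_finite_verts by (auto intro: finite_subset)
  moreover have "\<forall>v \<in> pverts G - (U \<union> V). \<forall>u. (u, v) \<notin> parcs G \<and> (v, u) \<notin> parcs G"
    unfolding UV(2) by auto
  ultimately show "complete_bipartite_with_isolated G"
    unfolding complete_bipartite_with_isolated_def by (metis Diff_subset)
qed

section \<open>The triangle formula and its equality case\<close>

lemma (in pair_graph) mat_trace_adj_matrix_pow:
  assumes vs: "distinct vs" "set vs = pverts G"
  shows "mat_trace (adj_matrix G vs ^\<^sub>m 1) = 0"
    and "mat_trace (adj_matrix G vs ^\<^sub>m 2) = 2 * num_edges G"
    and "mat_trace (adj_matrix G vs ^\<^sub>m 3) = 6 * card (triangles G)"
proof -
  let ?A = "adj_matrix G vs" and ?n = "length vs"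
  note A = adj_matrix_carrier[of G vs]
  show "mat_trace (?A ^\<^sub>m 1) = 0"
    using A by (simp add: mat_trace_def index_adj_matrix arcs_irrefl)
  have "mat_trace (?A ^\<^sub>m 2) = (\<Sum>i<?n. \<Sum>j<?n. ?A $$ (i, j) * ?A $$ (i, j))"
    using frobenius_pow_eq_trace[OF A transpose_adj_matrix, of 1 1] A
    by (simp add: numeral_2_eq_2)
  also have "\<dots> = (\<Sum>i<?n. \<Sum>j<?n. of_bool ((vs ! i, vs ! j) \<in> parcs G))"
    by (intro sum.cong) (auto simp: index_adj_matrix)
  also have "\<dots> = (\<Sum>u\<in>pverts G. \<Sum>v\<in>pverts G. of_bool ((u, v) \<in> parcs G))"
    unfolding vs(2)[symmetric] sum_nth_eq_sum_set[OF vs(1), symmetric] ..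
  also have "\<dots> = card (parcs G)"
    using card_filter_arcs[of "\<lambda>_ _. True"] by simp
  finally show "mat_trace (?A ^\<^sub>m 2) = 2 * num_edges G"
    by (simp add: card_arcs)
  have "mat_trace (?A ^\<^sub>m 3) = (\<Sum>i<?n. real (card (walks3 G (vs ! i) (vs ! i))))"
    using A by (auto simp: mat_trace_def adj_matrix_cube[OF vs] simp del: pow_mat.simps
        intro!: sum.cong)
  also have "\<dots> = real (\<Sum>u\<in>pverts G. card (walks3 G u u))"
    unfolding vs(2)[symmetric] sum_nth_eq_sum_set[OF vs(1), symmetric] by simp
  finally show "mat_trace (?A ^\<^sub>m 3) = 6 * card (triangles G)"
    unfolding sum_card_closed_walks3 by simp
qed

lemma (in pair_graph) adj_matrix_cube_eq_iff_bipartite: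
  assumes vs: "distinct vs" "set vs = pverts G"
  shows "(\<forall>i<length vs. \<forall>j<length vs. (adj_matrix G vs ^\<^sub>m 3) $$ (i, j)
      = num_edges G * adj_matrix G vs $$ (i, j)) \<longleftrightarrow> complete_bipartite_with_isolated G"
    (is "?L \<longleftrightarrow> _")
proof -
  have "?L \<longleftrightarrow> (\<forall>i<length vs. \<forall>j<length vs. card (walks3 G (vs ! i) (vs ! j))
      = (if (vs ! i, vs ! j) \<in> parcs G then num_edges G else 0))"
    by (auto simp: adj_matrix_cube[OF vs] index_adj_matrix simp del: pow_mat.simps)
  also have "\<dots> \<longleftrightarrow> (\<forall>u\<in>pverts G. \<forall>v\<in>pverts G. card (walks3 G u v)
      = (if (u, v) \<in> parcs G then num_edges G else 0))"
    unfolding vs(2)[symmetric] all_set_conv_all_nth ..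
  also have "\<dots> \<longleftrightarrow> complete_bipartite_with_isolated G"
    unfolding complete_bipartite_with_isolated_iff
    using bipartite_if_card_walks3 card_walks3_bipartite by blast
  finally show ?thesis .
qed

lemma (in pair_graph) no_triangles_if_bipartite:
  assumes "complete_bipartite_with_isolated G"
  shows "card (triangles G) = 0"
proof -
  obtain U V where UV: "U \<inter> V = {}" "parcs G = U \<times> V \<union> V \<times> U"
    using assms by (auto simp: complete_bipartite_with_isolated_iff)
  have "6 * card (triangles G) = (\<Sum>u\<in>pverts G. 0)"
    unfolding sum_card_closed_walks3[symmetric]
    by (intro sum.cong) (auto simp: card_walks3_bipartite[OF UV] arcs_irrefl)
  then show ?thesis by simp
qed

text \<open>
  The extremal sum consists of nonnegative terms, so each \<open>x i\<close> with \<open>i \<ge> 2\<close> is \<open>0\<close> or \<open>- x 1\<close> and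
  satisfies \<open>(x i)\<^sup>2 = - x 1 * x i\<close>. Summing this and using that all \<open>x i\<close> add up to zero gives
  \<open>m = (x 1)\<^sup>2\<close>.
\<close>

lemma cube_eq_if_extremal:
  fixes x :: "nat \<Rightarrow> real"
  assumes n: "n \<ge> 1" and bound: "\<And>i. i \<in> {1..n} \<Longrightarrow> \<bar>x i\<bar> \<le> x 1"
    and p1: "(\<Sum>i=1..n. x i) = 0" and p2: "(\<Sum>i=1..n. (x i)\<^sup>2) = 2 * m"
    and extremal: "(\<Sum>i=2..n. (x 1 + x i) * (x i)\<^sup>2) = 0"
    and i: "i \<in> {1..n}"
  shows "x i ^ 3 = m * x i"
proof -
  have split: "sum f {1..n} = f 1 + sum f {2..n}" for f :: "nat \<Rightarrow> real"
    using n by (simp add: sum.atLeast_Suc_atMost numeral_2_eq_2)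
  have "(x 1 + x i) * (x i)\<^sup>2 = 0" if "i \<in> {2..n}" for i
  proof -
    have "(x 1 + x i) * (x i)\<^sup>2 \<ge> 0" if "i \<in> {2..n}" for i
      using bound[of i] that by (intro mult_nonneg_nonneg) (auto simp: abs_le_iff)
    then show ?thesis
      using extremal that by (subst (asm) sum_nonneg_eq_0_iff) auto
  qed
  then have zero: "x i = 0 \<or> x i = - x 1" if "i \<in> {2..n}" for i
    using that by (force simp: add_eq_0_iff)
  have "(x i)\<^sup>2 = - x 1 * x i" if "i \<in> {2..n}" for i
    using zero[OF that] by (auto simp: power2_eq_square)
  then have "(\<Sum>i=2..n. (x i)\<^sup>2) = (\<Sum>i=2..n. - x 1 * x i)"
    by (intro sum.cong) auto
  also have "\<dots> = (x 1)\<^sup>2"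
    using p1 split[of x] unfolding sum_distrib_left[symmetric]
    by (simp add: power2_eq_square add_eq_0_iff)
  finally have m: "m = (x 1)\<^sup>2"
    using p2 split[of "\<lambda>i. (x i)\<^sup>2"] by simp
  show ?thesis
  proof (cases "i = 1")
    case False
    with i zero[of i] m show ?thesis by (auto simp: power2_eq_square power3_eq_cube)
  qed (simp add: m power2_eq_square power3_eq_cube)
qed

theorem theorem8:
  fixes G :: "'a pair_pre_digraph" and vs :: "'a list"
    and n m t :: nat and ev :: "nat \<Rightarrow> real" and \<rho> :: real
  assumes graph: "pair_graph G"
    and nonempty: "pverts G \<noteq> {}"
    and enumeration: "distinct vs" "set vs = pverts G"
    and n: "n = card (pverts G)"
    and m: "m = num_edges G"
    and t: "t = card (triangles G)"
    and eigenvalues: "\<And>i. i \<in> {1..n} \<Longrightarrow> ev i = eigenvalue_list (adj_matrix G vs) ! (i - 1)"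
    and spectral_radius: "\<rho> = spectral_radius (map_mat complex_of_real (adj_matrix G vs))"
  shows "real t = 1 / 6 * (\<Sum>i = 2..n. (ev 1 + ev i) * (ev i)\<^sup>2)
                    + ev 1 * ((ev 1)\<^sup>2 - real m) / 3
    \<and> 1 / 6 * (\<Sum>i = 2..n. (ev 1 + ev i) * (ev i)\<^sup>2) + ev 1 * ((ev 1)\<^sup>2 - real m) / 3
        \<ge> \<rho> * (\<rho>\<^sup>2 - real m) / 3
    \<and> (real t = \<rho> * (\<rho>\<^sup>2 - real m) / 3 \<longleftrightarrow> complete_bipartite_with_isolated G)"
proof -
  interpret pair_graph G by fact
  let ?A = "adj_matrix G vs"
  define es where "es = eigenvalue_list ?A"
  have len_vs: "length vs = n"
    using distinct_card[OF enumeration(1)] enumeration(2) n by simp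
  have A: "?A \<in> carrier_mat n n"
    using adj_matrix_carrier[of G vs] len_vs by simp
  have n1: "n \<ge> 1"
    using nonempty pair_finite_verts by (simp add: n Suc_le_eq card_gt_0_iff)
  have len: "length es = n"
    using length_eigenvalue_list_adj_matrix[OF graph enumeration] by (simp add: es_def n)
  have cp: "char_poly ?A = (\<Prod>e\<leftarrow>es. [:- e, 1:])"
    unfolding es_def by (rule char_poly_adj_matrix[OF graph enumeration])
  have ev: "ev i = es ! (i - 1)" if "i \<in> {1..n}" for i
    using eigenvalues that by (simp add: es_def)
  have es: "es = map ev [1..<Suc n]"
    using len ev by (intro nth_equalityI) (auto simp del: upt_Suc)
  have set_es: "set es = ev ` {1..n}"
    unfolding es by (auto simp del: upt_Suc)
  have "sorted (rev es)"
    by (simp add: es_def eigenvalue_list_def)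
  then have "e \<le> ev 1" if "e \<in> set es" for e
    using that n1 len by (auto simp: ev in_set_conv_nth sorted_rev_iff_nth_mono)
  moreover have "ev 1 \<in> set es"
    using n1 by (auto simp: set_es)
  moreover have "?A $$ (i, j) \<ge> 0" if "i < n" "j < n" for i j
    using that len_vs by (simp add: index_adj_matrix)
  ultimately have rho: "\<rho> = ev 1" and abs: "\<And>e. e \<in> set es \<Longrightarrow> \<bar>e\<bar> \<le> ev 1"
    using spectral_radius_nonneg_mat[OF A _ cp] spectral_radius by auto

  have power_sum: "(\<Sum>i=1..n. ev i ^ k) = mat_trace (?A ^\<^sub>m k)" for k
    unfolding mat_trace_pow_eq_power_sum[OF A cp] es
    by (simp add: sum_list_distinct_conv_sum_set atLeastLessThanSuc_atLeastAtMost comp_def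
        del: upt_Suc)
  have p1: "(\<Sum>i=1..n. ev i) = 0" and p2: "(\<Sum>i=1..n. (ev i)\<^sup>2) = 2 * real m"
    and p3: "(\<Sum>i=1..n. ev i ^ 3) = 6 * t"
    using power_sum[of 1] power_sum[of 2] power_sum[of 3]
      mat_trace_adj_matrix_pow[OF enumeration] by (simp_all add: m t)

  define S where "S = (\<Sum>i=2..n. (ev 1 + ev i) * (ev i)\<^sup>2)"
  have split: "sum f {1..n} = f 1 + sum f {2..n}" for f :: "nat \<Rightarrow> real"
    using n1 by (simp add: sum.atLeast_Suc_atMost numeral_2_eq_2)
  have "S = ev 1 * (\<Sum>i=2..n. (ev i)\<^sup>2) + (\<Sum>i=2..n. ev i ^ 3)"
    unfolding S_def sum_distrib_left sum.distrib[symmetric]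
    by (intro sum.cong) (auto simp: power2_eq_square power3_eq_cube algebra_simps)
  also have "\<dots> = ev 1 * (2 * m - (ev 1)\<^sup>2) + (6 * t - ev 1 ^ 3)"
    using p2 p3 split[of "\<lambda>i. (ev i)\<^sup>2"] split[of "\<lambda>i. ev i ^ 3"] by simp
  finally have eq: "real t = 1 / 6 * S + ev 1 * ((ev 1)\<^sup>2 - real m) / 3"
    by (simp add: field_simps power2_eq_square power3_eq_cube)
  have abs': "\<bar>ev i\<bar> \<le> ev 1" if "i \<in> {1..n}" for i
    using abs that by (auto simp: set_es)
  have S_nonneg: "S \<ge> 0"
    unfolding S_def
  proof (intro sum_nonneg mult_nonneg_nonneg)
    fix i assume "i \<in> {2..n}"
    then show "0 \<le> ev 1 + ev i"
      using abs'[of i] by (auto simp: abs_le_iff)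
  qed simp

  have cube_iff: "(\<forall>e\<in>set es. e ^ 3 = m * e) \<longleftrightarrow> complete_bipartite_with_isolated G"
    using symmetric_cube_eq_smult_iff[OF A transpose_adj_matrix cp, of m]
      adj_matrix_cube_eq_iff_bipartite[OF enumeration] by (simp add: len_vs m)
  have "real t = \<rho> * (\<rho>\<^sup>2 - real m) / 3 \<longleftrightarrow> complete_bipartite_with_isolated G"
  proof
    assume "real t = \<rho> * (\<rho>\<^sup>2 - real m) / 3"
    then have "S = 0"
      using eq by (simp add: rho)
    then have "ev i ^ 3 = m * ev i" if "i \<in> {1..n}" for i
      using cube_eq_if_extremal[OF n1 abs' p1 p2 _ that] by (simp add: S_def)
    then show "complete_bipartite_with_isolated G"
      unfolding cube_iff[symmetric] set_es by blast
  next
    assume cb: "complete_bipartite_with_isolated G"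
    then have "ev 1 ^ 3 = m * ev 1"
      using n1 unfolding cube_iff[symmetric] set_es by auto
    moreover have "t = 0"
      using no_triangles_if_bipartite[OF cb] t by simp
    ultimately show "real t = \<rho> * (\<rho>\<^sup>2 - real m) / 3"
      by (auto simp: rho power2_eq_square power3_eq_cube algebra_simps)
  qed
  with eq S_nonneg show ?thesis
    by (simp add: S_def rho)
qed

end
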